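(* Let $(\Omega,\mathcal A,\mu)$ be a measure space, $(X,\rho)$ a separable metric space, $\mathbb K\in\{\mathbb R,\mathbb C\}$, and $Y$ a separable Banach space over $\mathbb K$. Let $\lambda\in[0,1)$, $L\in[0,+\infty)$, and let $f\colon X\times\Omega\to X$, $g\colon\Omega\to\mathbb K$, $F\colon X\to Y$ satisfy: (H$_1$) for every $x\in X$ and every Borel set $B\subset X$, $\{\omega\in\Omega: f(x,\omega)\in B\}\in\mathcal A$; (H$_2$) $g$ is integrable, $\int_\Omega|g(\omega)|\rho(f(x,\omega),x)\,\mu(d\omega)<\infty$ for every $x\in X$, and $\int_\Omega|g(\omega)|\rho(f(x,\omega),f(z,\omega))\,\mu(d\omega)\le\lambda\rho(x,z)$ for all $x,z\in X$; (H$_3$) $\|F(x)-F(z)\|\le L\rho(x,z)$ for all $x,z\in X$. Put $\gamma=\int_\Omega g(\omega)\,\mu(d\omega)$ and let $(F_n)_{n\ge0}$ be the functions $X\to Y$ defined by $F_0(x)=F(x)$ and $F_n(x)=\int_\Omega g(\omega)F_{n-1}(f(x,\omega))\,\mu(d\omega)$ for $x\in X$, $n\in\mathbb N$. If $\gamma\neq1$, then the equation $$\varphi(x)=\int_\Omega g(\omega)\varphi\big(f(x,\omega)\big)\,\mu(d\omega)+F(x)\qquad(x\in X)$$ has exactly one Lipschitzian solution $\varphi\colon X\to Y$; it is given by the formula $$\varphi(x)=\frac{1}{1-\gamma}\left(\sum_{n=1}^{\infty}\big(F_n(x)-\gamma F_{n-1}(x)\big)+F(x)\right)\quad\text{for every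 }x\in X,$$ and it satisfies $$\|\varphi(x)-\varphi(z)\|\le\frac{L(1+|\gamma|)}{|1-\gamma|(1-\lambda)}\,\rho(x,z)\quad\text{for all }x,z\in X$$ and $$\|\varphi(x)\|\le\frac{1}{|1-\gamma|}\left(\frac{L}{1-\lambda}\int_\Omega|g(\omega)|\rho\big(f(x,\omega),x\big)\,\mu(d\omega)+\|F(x)\|\right)\quad\text{for every }x\in X.$$
   Context: Integrals of vector-valued functions are Bochner integrals. Under (H$_1$)--(H$_3$) the functions $F_n$ are well defined: for each $n$ the function $F_{n-1}$ is Lipschitzian and $\omega\mapsto g(\omega)F_{n-1}(f(x,\omega))$ is Bochner integrable for every $x\in X$. A solution of the equation is a function $\varphi\colon X\to Y$ such that for every $x\in X$ the function $\omega\mapsto g(\omega)\varphi(f(x,\omega))$ is Bochner integrable and the equality holds. Lipschitzian means satisfying a Lipschitz condition with some finite constant. *)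

theory Defs
  imports "HOL-Analysis.Analysis"
begin

text \<open>The scalar field K is the field of reals or the field of complex numbers. The norm is
  multiplicative, so it is the usual absolute value in both cases.\<close>

class real_or_complex = real_normed_field + banach + second_countable_topology +
  assumes real_or_complex:
    "(\<forall>z. \<exists>a. z = a *\<^sub>R 1) \<or>
     (\<exists>i. i * i = - 1 \<and> (\<forall>z. \<exists>a b. z = a *\<^sub>R 1 + b *\<^sub>R i))"

instance real :: real_or_complex
  by standard simp

instance complex :: real_or_complex
proof
  have "\<exists>a b. z = a *\<^sub>R 1 + b *\<^sub>R \<i>" for z
    by (intro exI[of _ "Re z"] exI[of _ "Im z"]) (simp add: complex_eq_iff)
  then show "(\<forall>z :: complex. \<exists>a. z = a *\<^sub>R 1) \<or>
      (\<exists>i :: complex. i * i = - 1 \<and> (\<forall>z. \<exists>a b. z = a *\<^sub>R 1 + b *\<^sub>R i))"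
    by (intro disjI2 exI[of _ "\<i>"]) simp
qed

text \<open>A Banach space over K is a real Banach space together with a scalar multiplication by
  elements of K that extends the real one and for which the given norm is a norm over K.
  Bochner integrals depend only on the underlying real Banach space.\<close>

locale banach_space_over = vector_space smul
  for smul :: "'k::real_or_complex \<Rightarrow> 'y::banach \<Rightarrow> 'y" +
  assumes smul_of_real: "smul (of_real r) y = r *\<^sub>R y"
    and norm_smul: "norm (smul c y) = norm c * norm y"

primrec F_seq :: "('k \<Rightarrow> 'y \<Rightarrow> 'y) \<Rightarrow> 'w measure \<Rightarrow> ('x \<Rightarrow> 'w \<Rightarrow> 'x) \<Rightarrow> ('w \<Rightarrow> 'k) \<Rightarrow> ('x \<Rightarrow> 'y)
    \<Rightarrow> nat \<Rightarrow> 'x \<Rightarrow> 'y::{banach, second_countable_topology}"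
  where
    "F_seq smul M f g F 0 = F"
  | "F_seq smul M f g F (Suc n) = (\<lambda>x. \<integral>\<omega>. smul (g \<omega>) (F_seq smul M f g F n (f x \<omega>)) \<partial>M)"

definition is_solution :: "('k \<Rightarrow> 'y \<Rightarrow> 'y) \<Rightarrow> 'w measure \<Rightarrow> ('x \<Rightarrow> 'w \<Rightarrow> 'x) \<Rightarrow> ('w \<Rightarrow> 'k) \<Rightarrow> ('x \<Rightarrow> 'y)
    \<Rightarrow> ('x \<Rightarrow> 'y::{banach, second_countable_topology}) \<Rightarrow> bool"
  where
    "is_solution smul M f g F \<phi> \<longleftrightarrow>
      (\<forall>x. integrable M (\<lambda>\<omega>. smul (g \<omega>) (\<phi> (f x \<omega>))) \<and>
           \<phi> x = (\<integral>\<omega>. smul (g \<omega>) (\<phi> (f x \<omega>)) \<partial>M) + F x)"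

definition Lipschitzian :: "('x::metric_space \<Rightarrow> 'y::metric_space) \<Rightarrow> bool"
  where "Lipschitzian \<phi> \<longleftrightarrow> (\<exists>C. C-lipschitz_on UNIV \<phi>)"

end

theory Submission
  imports Defs
begin

text \<open>Write \<open>(T \<phi>) x = \<integral> g \<phi>(f x \<omega>) d\<mu>\<close>. By (H2), \<open>T\<close> multiplies Lipschitz constants
  by \<open>\<lambda>\<close>, and \<open>T \<phi> - \<gamma> \<phi>\<close> is bounded at \<open>x\<close> by the Lipschitz constant of \<open>\<phi>\<close> times
  \<open>\<integral> |g| \<rho>(f x \<omega>, x) d\<mu>\<close>. Hence \<open>d\<^sub>n = F\<^sub>n\<^sub>+\<^sub>1 - \<gamma> F\<^sub>n\<close> decays geometrically, both pointwise and in
  its Lipschitz constant, so that \<open>T\<close> may be applied termwise to \<open>S = \<Sum> d\<^sub>n\<close>; as \<open>T d\<^sub>n = d\<^sub>n\<^sub>+\<^sub>1\<close>, this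
  gives \<open>T S = S - F\<^sub>1 + \<gamma> F\<close>, which is the equation for \<open>(S + F) / (1 - \<gamma>)\<close>. The difference of two
  Lipschitzian solutions is a Lipschitzian fixed point of \<open>T\<close>, hence a constant \<open>c\<close> with
  \<open>c = \<gamma> c\<close>, hence zero.\<close>

section \<open>Auxiliary facts on series, integrals and scalar multiplication\<close>

text \<open>Increments of the sum are bounded term by term by \<open>C n * dist x z\<close>. It
  serves both the full series and its tails, whose constants tend to 0.\<close>

lemma lipschitz_on_suminf:
  fixes h :: "nat \<Rightarrow> 'a::metric_space \<Rightarrow> 'b::banach"
  assumes lip: "\<And>n. (C n)-lipschitz_on U (h n)" and C: "summable C"
    and h: "\<And>x. x \<in> U \<Longrightarrow> summable (\<lambda>n. h n x)"
  shows "(\<Sum>n. C n)-lipschitz_on U (\<lambda>x. \<Sum>n. h n x)"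
proof (rule lipschitz_onI)
  fix x z assume xz: "x \<in> U" "z \<in> U"
  have "norm ((\<Sum>n. h n x) - (\<Sum>n. h n z)) = norm (\<Sum>n. h n x - h n z)"
    using xz by (simp add: suminf_diff h)
  also have "\<dots> \<le> (\<Sum>n. C n * dist x z)"
    using lipschitz_onD[OF lip xz] C
    by (intro norm_suminf_le summable_mult2) (simp_all add: dist_norm)
  also have "\<dots> = (\<Sum>n. C n) * dist x z"
    by (rule suminf_mult2[OF C, symmetric])
  finally show "dist (\<Sum>n. h n x) (\<Sum>n. h n z) \<le> (\<Sum>n. C n) * dist x z"
    by (simp add: dist_norm)
next
  show "0 \<le> (\<Sum>n. C n)"
    using C lipschitz_on_nonneg[OF lip] by (intro suminf_nonneg)
qed

text \<open>The library version \<open>integral_norm_bound_integral\<close> requires a Euclidean domain.\<close>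

lemma norm_integral_le_integral:
  fixes u :: "'a \<Rightarrow> 'b::{banach, second_countable_topology}"
  assumes "integrable M u" "integrable M v" "\<And>\<omega>. norm (u \<omega>) \<le> v \<omega>"
  shows "norm (\<integral>\<omega>. u \<omega> \<partial>M) \<le> (\<integral>\<omega>. v \<omega> \<partial>M)"
  using assms by (intro order_trans[OF integral_norm_bound integral_mono]) simp_all

text \<open>Makes scalar multiplication jointly continuous, hence measurable, and lets it pass
  through limits and Bochner integrals in either argument.\<close>

lemma (in banach_space_over) bounded_bilinear_smul: "bounded_bilinear smul"
proof
  show "smul (r *\<^sub>R a) b = r *\<^sub>R smul a b" for r a b
    by (simp add: scaleR_conv_of_real flip: smul_of_real scale_scale)
  show "smul a (r *\<^sub>R b) = r *\<^sub>R smul a b" for r a b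
    by (simp add: mult.commute flip: smul_of_real)
  show "\<exists>K. \<forall>a b. norm (smul a b) \<le> norm a * norm b * K"
    by (intro exI[of _ 1]) (simp add: norm_smul)
qed (simp_all add: scale_left_distrib scale_right_distrib)

section \<open>The setting and integrability\<close>

text \<open>\<open>F\<close> stays outside, since the operator and its estimates concern all
  Lipschitzian functions. Bounds on nonnegative integrals carry finiteness with them, whereas the
  Bochner integral of a non-integrable function is 0 by default.\<close>

locale contractive_family = banach_space_over smul
  for smul :: "'k::real_or_complex \<Rightarrow> 'y::{banach, second_countable_topology} \<Rightarrow> 'y" +
  fixes M :: "'w measure"
    and f :: "'x::{metric_space, second_countable_topology} \<Rightarrow> 'w \<Rightarrow> 'x"
    and g :: "'w \<Rightarrow> 'k"
    and lam :: real
  assumes lam: "0 \<le> lam" "lam < 1"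
    and f_measurable [measurable]: "\<And>x. f x \<in> borel_measurable M"
    and g_integrable: "integrable M g"
    and displacement_finite: "\<And>x. (\<integral>\<^sup>+\<omega>. ennreal (norm (g \<omega>) * dist (f x \<omega>) x) \<partial>M) < \<infinity>"
    and contraction: "\<And>x z. (\<integral>\<^sup>+\<omega>. ennreal (norm (g \<omega>) * dist (f x \<omega>) (f z \<omega>)) \<partial>M)
                              \<le> ennreal (lam * dist x z)"
begin

interpretation smul: bounded_bilinear smul
  by (rule bounded_bilinear_smul)

definition T :: "('x \<Rightarrow> 'y) \<Rightarrow> 'x \<Rightarrow> 'y"
  where "T \<phi> x = (\<integral>\<omega>. smul (g \<omega>) (\<phi> (f x \<omega>)) \<partial>M)"

definition total :: 'k
  where "total = (\<integral>\<omega>. g \<omega> \<partial>M)"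

definition displacement :: "'x \<Rightarrow> real"
  where "displacement x = (\<integral>\<omega>. norm (g \<omega>) * dist (f x \<omega>) x \<partial>M)"

lemma g_measurable [measurable]: "g \<in> borel_measurable M"
  using g_integrable by simp

text \<open>Second countability of both factors makes the pair \<open>(u, v)\<close> Borel
  measurable.\<close>

lemma smul_measurable:
  assumes "u \<in> borel_measurable M" "v \<in> borel_measurable M"
  shows "(\<lambda>\<omega>. smul (u \<omega>) (v \<omega>)) \<in> borel_measurable M"
  by (rule borel_measurable_continuous_Pair[OF assms])
     (intro smul.continuous_on continuous_intros)

lemma integrable_displacement: "integrable M (\<lambda>\<omega>. norm (g \<omega>) * dist (f x \<omega>) x)"
  using displacement_finite[of x] by (intro integrableI_bounded) (simp_all add: abs_mult)

lemma integrable_contraction: "integrable M (\<lambda>\<omega>. norm (g \<omega>) * dist (f x \<omega>) (f z \<omega>))"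
  using contraction[of x z]
  by (intro integrableI_bounded) (auto simp: abs_mult intro: le_less_trans)

lemma integral_contraction_le:
  "(\<integral>\<omega>. norm (g \<omega>) * dist (f x \<omega>) (f z \<omega>) \<partial>M) \<le> lam * dist x z"
proof -
  have "ennreal (\<integral>\<omega>. norm (g \<omega>) * dist (f x \<omega>) (f z \<omega>) \<partial>M) \<le> ennreal (lam * dist x z)"
    using contraction[of x z]
    by (subst nn_integral_eq_integral[OF integrable_contraction, symmetric]) simp_all
  then show ?thesis
    using lam by (subst (asm) ennreal_le_iff) simp_all
qed

text \<open>A Lipschitzian function grows at most linearly away from \<open>x\<close>, so the
  integrand is dominated by a combination of the displacement integrand and
  \<open>norm (g \<omega>)\<close>.\<close>

lemma integrable_T:
  assumes lip: "C-lipschitz_on UNIV \<phi>"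
  shows "integrable M (\<lambda>\<omega>. smul (g \<omega>) (\<phi> (f x \<omega>)))"
proof (rule Bochner_Integration.integrable_bound)
  show "integrable M (\<lambda>\<omega>. C * (norm (g \<omega>) * dist (f x \<omega>) x) + norm (g \<omega>) * norm (\<phi> x))"
    using integrable_displacement g_integrable by simp
  have "\<phi> \<in> borel_measurable borel"
    by (intro borel_measurable_continuous_onI lipschitz_on_continuous_on[OF lip])
  then show "(\<lambda>\<omega>. smul (g \<omega>) (\<phi> (f x \<omega>))) \<in> borel_measurable M"
    by (intro smul_measurable) (auto intro: measurable_compose)
  have "norm (smul (g \<omega>) (\<phi> (f x \<omega>)))
      \<le> norm (C * (norm (g \<omega>) * dist (f x \<omega>) x) + norm (g \<omega>) * norm (\<phi> x))" for \<omega>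
  proof -
    have "norm (\<phi> (f x \<omega>)) \<le> norm (\<phi> (f x \<omega>) - \<phi> x) + norm (\<phi> x)"
      using norm_triangle_ineq[of "\<phi> (f x \<omega>) - \<phi> x" "\<phi> x"] by simp
    also have "\<dots> \<le> C * dist (f x \<omega>) x + norm (\<phi> x)"
      using lipschitz_onD[OF lip, of "f x \<omega>" x] by (simp add: dist_norm)
    finally have "norm (g \<omega>) * norm (\<phi> (f x \<omega>))
        \<le> norm (g \<omega>) * (C * dist (f x \<omega>) x + norm (\<phi> x))"
      by (intro mult_left_mono) simp_all
    then show ?thesis
      by (simp add: norm_smul algebra_simps abs_le_iff)
  qed
  then show "AE \<omega> in M. norm (smul (g \<omega>) (\<phi> (f x \<omega>)))
      \<le> norm (C * (norm (g \<omega>) * dist (f x \<omega>) x) + norm (g \<omega>) * norm (\<phi> x))"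
    by simp
qed

section \<open>Linearity of \<open>T\<close> and its Lipschitz estimates\<close>

lemma T_add:
  assumes "C-lipschitz_on UNIV \<phi>" "D-lipschitz_on UNIV \<psi>"
  shows "T (\<lambda>x. \<phi> x + \<psi> x) x = T \<phi> x + T \<psi> x"
  unfolding T_def using assms by (simp add: scale_right_distrib integrable_T)

lemma T_diff:
  assumes "C-lipschitz_on UNIV \<phi>" "D-lipschitz_on UNIV \<psi>"
  shows "T (\<lambda>x. \<phi> x - \<psi> x) x = T \<phi> x - T \<psi> x"
  unfolding T_def using assms by (simp add: scale_right_diff_distrib integrable_T)

lemma T_smul:
  assumes "C-lipschitz_on UNIV \<phi>"
  shows "T (\<lambda>x. smul c (\<phi> x)) x = smul c (T \<phi> x)"
proof -
  have "T (\<lambda>x. smul c (\<phi> x)) x = (\<integral>\<omega>. smul c (smul (g \<omega>) (\<phi> (f x \<omega>))) \<partial>M)"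
    by (simp add: T_def mult.commute)
  also have "\<dots> = smul c (T \<phi> x)"
    unfolding T_def
    by (rule integral_bounded_linear[OF smul.bounded_linear_right integrable_T[OF assms]])
  finally show ?thesis .
qed

text \<open>Nonzero constants are eigenvectors of \<open>T\<close> with eigenvalue
  \<open>total\<close>; this is why 1 is the critical value of \<open>total\<close>.\<close>

lemma T_const: "T (\<lambda>_. c) x = smul total c"
  unfolding T_def total_def
  by (rule integral_bounded_linear[OF smul.bounded_linear_left g_integrable])

lemma lipschitz_on_smul:
  assumes "C-lipschitz_on UNIV \<phi>"
  shows "(norm c * C)-lipschitz_on UNIV (\<lambda>x. smul c (\<phi> x))"
proof (rule lipschitz_onI)
  show "dist (smul c (\<phi> x)) (smul c (\<phi> z)) \<le> norm c * C * dist x z" for x z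
    using mult_left_mono[OF lipschitz_onD[OF assms, of x z], of "norm c"]
    by (simp add: dist_norm norm_smul mult.assoc flip: scale_right_diff_distrib)
qed (simp add: lipschitz_on_nonneg[OF assms])

lemma lipschitz_on_T:
  assumes lip: "C-lipschitz_on UNIV \<phi>"
  shows "(lam * C)-lipschitz_on UNIV (T \<phi>)"
proof (rule lipschitz_onI)
  note C = lipschitz_on_nonneg[OF lip]
  then show "0 \<le> lam * C"
    using lam by simp
  fix x z
  have "norm (T \<phi> x - T \<phi> z) = norm (\<integral>\<omega>. smul (g \<omega>) (\<phi> (f x \<omega>) - \<phi> (f z \<omega>)) \<partial>M)"
    unfolding T_def by (simp add: scale_right_diff_distrib integrable_T[OF lip])
  also have "\<dots> \<le> (\<integral>\<omega>. C * (norm (g \<omega>) * dist (f x \<omega>) (f z \<omega>)) \<partial>M)"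
  proof (rule norm_integral_le_integral)
    show "integrable M (\<lambda>\<omega>. smul (g \<omega>) (\<phi> (f x \<omega>) - \<phi> (f z \<omega>)))"
      by (simp add: scale_right_diff_distrib integrable_T[OF lip])
    show "integrable M (\<lambda>\<omega>. C * (norm (g \<omega>) * dist (f x \<omega>) (f z \<omega>)))"
      using integrable_contraction by simp
    show "norm (smul (g \<omega>) (\<phi> (f x \<omega>) - \<phi> (f z \<omega>))) \<le> C * (norm (g \<omega>) * dist (f x \<omega>) (f z \<omega>))" for \<omega>
      using mult_left_mono[OF lipschitz_onD[OF lip, of "f x \<omega>" "f z \<omega>"], of "norm (g \<omega>)"]
      by (simp add: norm_smul dist_norm mult_ac)
  qed
  also have "\<dots> \<le> C * (lam * dist x z)"
    using mult_left_mono[OF integral_contraction_le C] by simp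
  finally show "dist (T \<phi> x) (T \<phi> z) \<le> lam * C * dist x z"
    by (simp add: dist_norm mult_ac)
qed

text \<open>Freezing \<open>\<phi>\<close> at its value in \<open>x\<close> turns the subtracted
  term into \<open>T\<close> of a constant, so only the increments
  \<open>\<phi> (f x \<omega>) - \<phi> x\<close> remain under the integral.\<close>

lemma norm_T_minus_smul_le:
  assumes lip: "C-lipschitz_on UNIV \<phi>"
  shows "norm (T \<phi> x - smul total (\<phi> x)) \<le> C * displacement x"
proof -
  have *: "integrable M (\<lambda>\<omega>. smul (g \<omega>) (\<phi> x))"
    by (rule integrable_bounded_linear[OF smul.bounded_linear_left g_integrable])
  have "norm (T \<phi> x - smul total (\<phi> x)) = norm (T \<phi> x - T (\<lambda>_. \<phi> x) x)"
    by (simp only: T_const)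
  also have "\<dots> = norm (\<integral>\<omega>. smul (g \<omega>) (\<phi> (f x \<omega>) - \<phi> x) \<partial>M)"
    unfolding T_def by (simp add: scale_right_diff_distrib integrable_T[OF lip] *)
  also have "\<dots> \<le> (\<integral>\<omega>. C * (norm (g \<omega>) * dist (f x \<omega>) x) \<partial>M)"
  proof (rule norm_integral_le_integral)
    show "integrable M (\<lambda>\<omega>. smul (g \<omega>) (\<phi> (f x \<omega>) - \<phi> x))"
      by (simp add: scale_right_diff_distrib integrable_T[OF lip] *)
    show "integrable M (\<lambda>\<omega>. C * (norm (g \<omega>) * dist (f x \<omega>) x))"
      using integrable_displacement by simp
    show "norm (smul (g \<omega>) (\<phi> (f x \<omega>) - \<phi> x)) \<le> C * (norm (g \<omega>) * dist (f x \<omega>) x)" for \<omega>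
      using mult_left_mono[OF lipschitz_onD[OF lip, of "f x \<omega>" x], of "norm (g \<omega>)"]
      by (simp add: norm_smul dist_norm mult_ac)
  qed
  finally show ?thesis
    by (simp add: displacement_def)
qed

section \<open>Termwise application of \<open>T\<close> to series\<close>

text \<open>The tail \<open>R N\<close> tends to 0 at \<open>x\<close>, and its Lipschitz constant
  tends to 0 as well. Hence \<open>T (R N) x\<close> differs from \<open>smul total (R N x)\<close>
  by a null sequence and tends to 0 itself.\<close>

lemma T_sums:
  assumes lip: "\<And>n. (C n)-lipschitz_on UNIV (h n)" and C: "summable C"
    and h: "\<And>x. summable (\<lambda>n. h n x)"
  shows "(\<lambda>n. T (h n) x) sums T (\<lambda>x. \<Sum>n. h n x) x"
proof -
  define S where "S = (\<lambda>x. \<Sum>n. h n x)"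
  define R where "R N x = (\<Sum>n. h (n + N) x)" for N x
  have R_eq: "R N x = S x - (\<Sum>n<N. h n x)" for N x
    unfolding R_def S_def by (rule suminf_minus_initial_segment[OF h])
  have R_lip: "(\<Sum>n. C (n + N))-lipschitz_on UNIV (R N)" for N
    unfolding R_def using lip summable_ignore_initial_segment[OF C] summable_ignore_initial_segment[OF h]
    by (intro lipschitz_on_suminf) auto
  have R_Suc: "T (R (Suc N)) x = T (R N) x - T (h N) x" for N
  proof -
    have "R (Suc N) = (\<lambda>x. R N x - h N x)"
      by (simp add: fun_eq_iff R_eq algebra_simps)
    then show ?thesis
      using T_diff[OF R_lip lip] by simp
  qed
  \<comment> \<open>Finite additivity in telescoped form, peeling one term off the tail at a
    time.\<close>
  have partial_sum: "(\<Sum>n<N. T (h n) x) = T S x - T (R N) x" for N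
  proof (induction N)
    case 0
    have "R 0 = S"
      by (simp add: R_eq fun_eq_iff)
    then show ?case by simp
  qed (simp add: R_Suc)
  have "(\<lambda>N. S x - (\<Sum>n<N. h n x)) \<longlonglongrightarrow> S x - S x"
    unfolding S_def by (intro tendsto_intros summable_LIMSEQ h)
  then have R_lim: "(\<lambda>N. R N x) \<longlonglongrightarrow> 0"
    by (simp add: R_eq)
  have "(\<lambda>N. (\<Sum>n. C n) - (\<Sum>n<N. C n)) \<longlonglongrightarrow> (\<Sum>n. C n) - (\<Sum>n. C n)"
    by (intro tendsto_intros summable_LIMSEQ C)
  then have C_lim: "(\<lambda>N. \<Sum>n. C (n + N)) \<longlonglongrightarrow> 0"
    by (simp add: suminf_minus_initial_segment[OF C])
  have "(\<lambda>N. T (R N) x - smul total (R N x)) \<longlonglongrightarrow> 0"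
    by (rule Lim_null_comparison[OF always_eventually tendsto_mult_left_zero[OF C_lim, of "displacement x"]])
       (intro allI norm_T_minus_smul_le R_lip)
  then have "(\<lambda>N. T (R N) x - smul total (R N x) + smul total (R N x)) \<longlonglongrightarrow> 0 + smul total 0"
    by (intro tendsto_add smul.tendsto tendsto_const R_lim)
  then have "(\<lambda>N. T (R N) x) \<longlonglongrightarrow> 0"
    by simp
  then have "(\<lambda>N. T S x - T (R N) x) \<longlonglongrightarrow> T S x - 0"
    by (intro tendsto_intros)
  then show ?thesis
    by (simp add: sums_def partial_sum S_def)
qed

section \<open>Lipschitzian fixed points of \<open>T\<close> and uniqueness\<close>

text \<open>Each application of \<open>T\<close> gains a factor \<open>lam\<close> but returns
  \<open>\<phi>\<close>, so \<open>lam ^ n * C\<close> is a Lipschitz constant of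
  \<open>\<phi>\<close> for every \<open>n\<close>.\<close>

lemma lipschitz_fixed_point_const:
  assumes lip: "C-lipschitz_on UNIV \<phi>" and fixed: "T \<phi> = \<phi>"
  shows "\<phi> x = \<phi> z"
proof -
  have "(lam ^ n * C)-lipschitz_on UNIV \<phi>" for n
  proof (induction n)
    case (Suc n)
    then show ?case
      using lipschitz_on_T[OF Suc] by (simp add: fixed mult_ac)
  qed (simp add: lip)
  then have "dist (\<phi> x) (\<phi> z) \<le> lam ^ n * C * dist x z" for n
    by (rule lipschitz_onD) auto
  moreover have "(\<lambda>n. lam ^ n * C * dist x z) \<longlonglongrightarrow> 0"
    using lam by (intro tendsto_mult_left_zero LIMSEQ_realpow_zero) auto
  ultimately have "dist (\<phi> x) (\<phi> z) \<le> 0"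
    by (intro LIMSEQ_le_const) auto
  then show ?thesis
    by simp
qed

lemma lipschitz_fixed_point_eq_0:
  assumes lip: "C-lipschitz_on UNIV \<phi>" and fixed: "T \<phi> = \<phi>" and "total \<noteq> 1"
  shows "\<phi> x = 0"
proof -
  have "\<phi> = (\<lambda>_. \<phi> x)"
    using lipschitz_fixed_point_const[OF lip fixed] by auto
  then have "smul total (\<phi> x) = \<phi> x"
    using fixed T_const[of "\<phi> x" x] by metis
  then have "smul (total - 1) (\<phi> x) = 0"
    by (simp add: scale_left_diff_distrib)
  then show ?thesis
    using \<open>total \<noteq> 1\<close> by simp
qed

text \<open>For Lipschitzian functions the integrability clause holds automatically.\<close>

lemma is_solution_iff:
  assumes "C-lipschitz_on UNIV \<phi>"
  shows "is_solution smul M f g F \<phi> \<longleftrightarrow> (\<forall>x. \<phi> x = T \<phi> x + F x)"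
  using integrable_T[OF assms] by (simp add: is_solution_def T_def)

lemma lipschitz_solution_unique:
  assumes "total \<noteq> 1"
    and lip: "C-lipschitz_on UNIV \<phi>" "D-lipschitz_on UNIV \<psi>"
    and sol: "is_solution smul M f g F \<phi>" "is_solution smul M f g F \<psi>"
  shows "\<phi> = \<psi>"
proof
  fix x
  \<comment> \<open>The inhomogeneous term \<open>F x\<close> cancels in the difference of the two
    equations.\<close>
  have "T (\<lambda>x. \<phi> x - \<psi> x) x = \<phi> x - \<psi> x" for x
    using sol T_diff[OF lip, of x] unfolding is_solution_iff[OF lip(1)] is_solution_iff[OF lip(2)]
    by (metis add_diff_cancel_right)
  then show "\<phi> x = \<psi> x"
    using lipschitz_fixed_point_eq_0[OF lipschitz_on_diff[OF lip] _ \<open>total \<noteq> 1\<close>, of x] by auto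
qed

section \<open>Construction of the solution as a series\<close>

context
  fixes F :: "'x \<Rightarrow> 'y" and L :: real
  assumes F_lip: "L-lipschitz_on UNIV F"
begin

text \<open>Indexed from 0: \<open>defect n\<close> is the term of index \<open>n + 1\<close> in the
  series of the theorem.\<close>

definition defect :: "nat \<Rightarrow> 'x \<Rightarrow> 'y"
  where "defect n x = F_seq smul M f g F (Suc n) x - smul total (F_seq smul M f g F n x)"

lemma F_seq_Suc_eq_T: "F_seq smul M f g F (Suc n) = T (F_seq smul M f g F n)"
  by (simp add: T_def fun_eq_iff)

lemma lipschitz_on_F_seq: "(L * lam ^ n)-lipschitz_on UNIV (F_seq smul M f g F n)"
proof (induction n)
  case (Suc n)
  show ?case
    unfolding F_seq_Suc_eq_T using lipschitz_on_T[OF Suc] by (simp add: mult_ac)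
qed (simp add: F_lip)

text \<open>The two terms contribute \<open>L * lam ^ (n + 1)\<close> and
  \<open>norm total * L * lam ^ n\<close>.\<close>

lemma lipschitz_on_defect: "(L * (lam + norm total) * lam ^ n)-lipschitz_on UNIV (defect n)"
  unfolding defect_def
  using lipschitz_on_diff[OF lipschitz_on_F_seq[of "Suc n"]
      lipschitz_on_smul[OF lipschitz_on_F_seq[of n], of total]]
  by (simp add: algebra_simps)

lemma T_defect: "T (defect n) x = defect (Suc n) x"
  unfolding defect_def
  by (simp only: T_diff[OF lipschitz_on_F_seq lipschitz_on_smul[OF lipschitz_on_F_seq]]
      T_smul[OF lipschitz_on_F_seq] flip: F_seq_Suc_eq_T)

lemma norm_defect_le: "norm (defect n x) \<le> L * displacement x * lam ^ n"
  unfolding defect_def F_seq_Suc_eq_T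
  using norm_T_minus_smul_le[OF lipschitz_on_F_seq, of n x] by (simp add: mult_ac)

lemma summable_geometric_mult: "summable (\<lambda>n. c * lam ^ n)"
  using lam by (intro summable_mult summable_geometric) simp

lemma suminf_geometric_mult: "(\<Sum>n. c * lam ^ n) = c / (1 - lam)"
  using lam by (simp add: suminf_mult suminf_geometric)

lemma summable_defect: "summable (\<lambda>n. defect n x)"
  by (rule summable_comparison_test'[OF summable_geometric_mult norm_defect_le])

lemma norm_suminf_defect_le: "norm (\<Sum>n. defect n x) \<le> L / (1 - lam) * displacement x"
  using norm_suminf_le[OF norm_defect_le summable_geometric_mult, of x]
  by (simp add: suminf_geometric_mult)

lemma lipschitz_on_suminf_defect:
  "(L * (lam + norm total) / (1 - lam))-lipschitz_on UNIV (\<lambda>x. \<Sum>n. defect n x)"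
  using lipschitz_on_suminf[OF lipschitz_on_defect summable_geometric_mult summable_defect]
  by (simp only: suminf_geometric_mult)

text \<open>\<open>T\<close> shifts the series by one index, so exactly the first term is
  lost.\<close>

lemma T_suminf_defect: "T (\<lambda>x. \<Sum>n. defect n x) x = (\<Sum>n. defect n x) - defect 0 x"
proof -
  have "(\<lambda>n. defect (Suc n) x) sums T (\<lambda>x. \<Sum>n. defect n x) x"
    using T_sums[OF lipschitz_on_defect summable_geometric_mult summable_defect, of x]
    by (simp only: T_defect)
  then show ?thesis
    using suminf_split_head[OF summable_defect, of x] by (simp add: sums_iff)
qed

definition sol :: "'x \<Rightarrow> 'y"
  where "sol x = smul (1 / (1 - total)) ((\<Sum>n. defect n x) + F x)"

lemma lipschitz_on_suminf_defect_add:
  "(L * (1 + norm total) / (1 - lam))-lipschitz_on UNIV (\<lambda>x. (\<Sum>n. defect n x) + F x)"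
proof -
  \<comment> \<open>Writing the constant of \<open>F\<close> as
    \<open>L * (1 - lam) / (1 - lam)\<close> makes \<open>lam\<close> cancel in the
    numerator.\<close>
  have "L * (lam + norm total) / (1 - lam) + L = L * (1 + norm total) / (1 - lam)"
    using lam by (simp add: field_simps)
  then show ?thesis
    using lipschitz_on_add[OF lipschitz_on_suminf_defect F_lip] by simp
qed

lemma lipschitz_on_sol:
  "(L * (1 + norm total) / (norm (1 - total) * (1 - lam)))-lipschitz_on UNIV sol"
  unfolding sol_def
  using lipschitz_on_smul[OF lipschitz_on_suminf_defect_add, of "1 / (1 - total)"]
  by (simp add: norm_divide mult_ac)

lemma norm_sol_le:
  "norm (sol x) \<le> 1 / norm (1 - total) * (L / (1 - lam) * displacement x + norm (F x))"
proof -
  have "norm ((\<Sum>n. defect n x) + F x) \<le> L / (1 - lam) * displacement x + norm (F x)"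
    using norm_triangle_ineq norm_suminf_defect_le by (rule order_trans[OF _ add_right_mono])
  then show ?thesis
    unfolding sol_def norm_smul by (intro mult_mono) (simp_all add: norm_divide)
qed

lemma is_solution_sol:
  assumes "total \<noteq> 1"
  shows "is_solution smul M f g F sol"
  unfolding is_solution_iff[OF lipschitz_on_sol]
proof
  fix x
  let ?S = "\<Sum>n. defect n x"
  have "T sol x = smul (1 / (1 - total)) (T (\<lambda>x. (\<Sum>n. defect n x) + F x) x)"
    unfolding sol_def by (rule T_smul[OF lipschitz_on_suminf_defect_add])
  also have "T (\<lambda>x. (\<Sum>n. defect n x) + F x) x = ?S - defect 0 x + T F x"
    by (simp add: T_add[OF lipschitz_on_suminf_defect F_lip] T_suminf_defect)
  \<comment> \<open>Since \<open>defect 0 x\<close> is \<open>T F x - smul total (F x)\<close>, both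
    sides equal \<open>?S + smul total (F x)\<close>.\<close>
  also have "\<dots> = ?S + F x - smul (1 - total) (F x)"
    by (simp only: defect_def F_seq_Suc_eq_T F_seq.simps(1) scale_left_diff_distrib scale_one)
       (simp add: algebra_simps)
  \<comment> \<open>Here \<open>total \<noteq> 1\<close> enters: the normalizing factor cancels
    \<open>1 - total\<close> and leaves \<open>F x\<close>.\<close>
  also have "smul (1 / (1 - total)) \<dots> = sol x - F x"
    using assms by (simp add: sol_def scale_right_diff_distrib)
  finally show "sol x = T sol x + F x"
    by simp
qed

end

end

theorem theorem2p3:
  fixes M :: "'w measure"
    and smul :: "'k::real_or_complex \<Rightarrow> 'y::{banach, second_countable_topology} \<Rightarrow> 'y"
    and f :: "'x::{metric_space, second_countable_topology} \<Rightarrow> 'w \<Rightarrow> 'x"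
    and g :: "'w \<Rightarrow> 'k"
    and F :: "'x \<Rightarrow> 'y"
    and lam L :: real
    and \<gamma> :: 'k
    and Fn :: "nat \<Rightarrow> 'x \<Rightarrow> 'y"
  assumes Y: "banach_space_over smul"
    and lam: "0 \<le> lam" "lam < 1"
    and L: "0 \<le> L"
    and H1: "\<And>x B. B \<in> sets borel \<Longrightarrow> {\<omega> \<in> space M. f x \<omega> \<in> B} \<in> sets M"
    and H2_g: "integrable M g"
    and H2_fin: "\<And>x. (\<integral>\<^sup>+\<omega>. ennreal (norm (g \<omega>) * dist (f x \<omega>) x) \<partial>M) < \<infinity>"
    and H2_contr: "\<And>x z. (\<integral>\<^sup>+\<omega>. ennreal (norm (g \<omega>) * dist (f x \<omega>) (f z \<omega>)) \<partial>M)
                          \<le> ennreal (lam * dist x z)"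
    and H3: "\<And>x z. norm (F x - F z) \<le> L * dist x z"
    and \<gamma>: "\<gamma> = (\<integral>\<omega>. g \<omega> \<partial>M)"
    and Fn: "Fn = F_seq smul M f g F"
    and \<gamma>_neq_1: "\<gamma> \<noteq> 1"
  shows "(\<exists>!\<phi>. Lipschitzian \<phi> \<and> is_solution smul M f g F \<phi>) \<and>
    (\<forall>\<phi>. Lipschitzian \<phi> \<and> is_solution smul M f g F \<phi> \<longrightarrow>
      (\<forall>x. summable (\<lambda>n. Fn (Suc n) x - smul \<gamma> (Fn n x)) \<and>
           \<phi> x = smul (1 / (1 - \<gamma>)) ((\<Sum>n. Fn (Suc n) x - smul \<gamma> (Fn n x)) + F x)) \<and>
      (\<forall>x z. norm (\<phi> x - \<phi> z)
             \<le> L * (1 + norm \<gamma>) / (norm (1 - \<gamma>) * (1 - lam)) * dist x z) \<and>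
      (\<forall>x. norm (\<phi> x)
           \<le> 1 / norm (1 - \<gamma>) *
             (L / (1 - lam) * (\<integral>\<omega>. norm (g \<omega>) * dist (f x \<omega>) x \<partial>M) + norm (F x))))"
proof -
  interpret contractive_family smul M f g lam
  proof (intro contractive_family.intro contractive_family_axioms.intro Y)
    show "f x \<in> borel_measurable M" for x
    proof (rule measurableI)
      show "f x -` B \<inter> space M \<in> sets M" if "B \<in> sets borel" for B
        using H1[OF that, of x] by (simp add: vimage_def Int_def conj_commute)
    qed simp
  qed (use lam H2_g H2_fin H2_contr in auto)
  have F_lip: "L-lipschitz_on UNIV F"
    using H3 L by (intro lipschitz_onI) (simp_all add: dist_norm)
  have total: "total = \<gamma>"
    by (simp add: \<gamma> total_def)
  let ?\<phi> = "sol F"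
  have \<phi>: "Lipschitzian ?\<phi> \<and> is_solution smul M f g F ?\<phi>"
    using lipschitz_on_sol[OF F_lip] is_solution_sol[OF F_lip] \<gamma>_neq_1
    by (auto simp: Lipschitzian_def total)
  \<comment> \<open>Identifying any Lipschitzian solution with \<open>sol F\<close> transfers the
    formula and both estimates to it.\<close>
  have unique: "\<phi> = ?\<phi>" if "Lipschitzian \<phi> \<and> is_solution smul M f g F \<phi>" for \<phi>
    using that \<phi> lipschitz_solution_unique \<gamma>_neq_1 unfolding Lipschitzian_def total by blast
  have defect: "Fn (Suc n) x - smul \<gamma> (Fn n x) = defect F n x" for n x
    by (simp only: Fn defect_def[OF F_lip] total)
  show ?thesis
  proof (intro conjI allI impI)
    show "\<exists>!\<phi>. Lipschitzian \<phi> \<and> is_solution smul M f g F \<phi>"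
      using \<phi> unique by (rule ex1I)
  next
    fix \<phi> x
    show "summable (\<lambda>n. Fn (Suc n) x - smul \<gamma> (Fn n x))"
      unfolding defect by (rule summable_defect[OF F_lip])
    assume "Lipschitzian \<phi> \<and> is_solution smul M f g F \<phi>"
    note eq = unique[OF this]
    show "\<phi> x = smul (1 / (1 - \<gamma>)) ((\<Sum>n. Fn (Suc n) x - smul \<gamma> (Fn n x)) + F x)"
      unfolding eq defect by (simp only: sol_def[OF F_lip] total)
    show "norm (\<phi> x - \<phi> z)
        \<le> L * (1 + norm \<gamma>) / (norm (1 - \<gamma>) * (1 - lam)) * dist x z" for z
      using lipschitz_onD[OF lipschitz_on_sol[OF F_lip], of x z]
      by (simp only: eq total dist_norm UNIV_I simp_thms)
    show "norm (\<phi> x) \<le> 1 / norm (1 - \<gamma>) *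
        (L / (1 - lam) * (\<integral>\<omega>. norm (g \<omega>) * dist (f x \<omega>) x \<partial>M) + norm (F x))"
      using norm_sol_le[OF F_lip, of x] by (simp only: eq total displacement_def)
  qed
qed

end
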